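(* Let $H$ be an infinite-dimensional separable complex Hilbert space and let $T\in\mathcal{B}(H)$ be a positive operator. Then $T\in\mathcal{M}_r(H)$ if and only if there exist a countable set $\Lambda\subseteq[0,\|T\|]$, well-ordered by the usual order of $\mathbb{R}$, and a family $(P_\lambda)_{\lambda\in\Lambda}$ of mutually orthogonal nonzero orthogonal projections on $H$ such that $$\sum_{\lambda\in\Lambda}P_\lambda=I\quad\text{and}\quad T=\sum_{\lambda\in\Lambda}\lambda P_\lambda,$$ where both series converge in the strong operator topology. Furthermore, for any such representation, $\sigma(T)=\overline{\Lambda}$.
   Context: $\mathcal{B}(H)$ denotes the bounded linear operators on $H$, and $T$ is positive if $\langle Tx,x\rangle\ge 0$ for all $x\in H$. For a nonzero Hilbert space $M$ and $A\in\mathcal{B}(M)$, the minimum modulus is $m(A)=\inf\{\|Ax\|: x\in M,\ \|x\|=1\}$; $A$ is minimum attaining if there is a unit vector $x_0\in M$ with $\|Ax_0\|=m(A)$. A closed subspace $M\subseteq H$ reduces $T$ if $T(M)\subseteq M$ and $T^*(M)\subseteq M$. $\mathcal{M}_r(H)$ is the set of all $T\in\mathcal{B}(H)$ such that for every nonzero closed subspace $M$ reducing $T$, the restriction $T|_M:M\to M$ is minimum attaining. $\sigma(T)$ is the spectrum of $T$. *)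

theory Defs
  imports "HOL-Analysis.Analysis"
begin

(* Complex inner product spaces are built on top of real_inner so that the norm, the topology and
   the summation theory of HOL-Analysis apply directly. The underlying real inner product is the
   real part of the complex one; by polarization it is determined by the norm, so cinner_Re adds
   nothing beyond norm x = sqrt (cinner x x). Positive definiteness is inherited from real_inner.
   The inner product is linear in its first argument. *)

class complex_inner = real_inner +
  fixes scaleC :: "complex \<Rightarrow> 'a \<Rightarrow> 'a" (infixr "*\<^sub>C" 75)
    and cinner :: "'a \<Rightarrow> 'a \<Rightarrow> complex"
  assumes scaleC_add_right: "a *\<^sub>C (x + y) = a *\<^sub>C x + a *\<^sub>C y"
    and scaleC_add_left: "(a + b) *\<^sub>C x = a *\<^sub>C x + b *\<^sub>C x"
    and scaleC_scaleC: "a *\<^sub>C (b *\<^sub>C x) = (a * b) *\<^sub>C x"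
    and scaleC_of_real: "complex_of_real r *\<^sub>C x = r *\<^sub>R x"
    and cinner_commute: "cinner x y = cnj (cinner y x)"
    and cinner_add_left: "cinner (x + y) z = cinner x z + cinner y z"
    and cinner_scaleC_left: "cinner (a *\<^sub>C x) y = a * cinner x y"
    and cinner_Re: "Re (cinner x y) = x \<bullet> y"

class chilbert_space = complex_inner + complete_space

lemma vector_space_scaleC:
  "vector_space (scaleC :: complex \<Rightarrow> 'a \<Rightarrow> 'a::complex_inner)"
proof
  show "1 *\<^sub>C x = x" for x :: 'a
    using scaleC_of_real[of 1 x] by simp
qed (simp_all add: scaleC_add_right scaleC_add_left scaleC_scaleC)

lemma cinner_self:
  fixes x :: "'a::complex_inner"
  shows "cinner x x = complex_of_real ((norm x)\<^sup>2)"
proof (rule complex_eqI)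
  show "Im (cinner x x) = Im (complex_of_real ((norm x)\<^sup>2))"
    using arg_cong[OF cinner_commute[of x x], of Im] by simp
qed (simp add: cinner_Re power2_norm_eq_inner)

definition infinite_dimensional :: "'a::complex_inner itself \<Rightarrow> bool" where
  "infinite_dimensional _ \<longleftrightarrow>
     \<not> (\<exists>B :: 'a set. finite B \<and> module.span scaleC B = UNIV)"

(* B(H), as a set of functions; the operator norm of T is onorm T. *)
definition bounded_operators :: "('a::complex_inner \<Rightarrow> 'a) set" where
  "bounded_operators =
     {T. bounded_linear T \<and> (\<forall>c x. T (c *\<^sub>C x) = c *\<^sub>C T x)}"

(* Only meaningful for bounded T on a Hilbert space, where the adjoint exists;
   uniqueness holds for every T. *)
definition cadjoint :: "('a::chilbert_space \<Rightarrow> 'a) \<Rightarrow> 'a \<Rightarrow> 'a" where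
  "cadjoint T = (THE S. \<forall>x y. cinner (T x) y = cinner x (S y))"

definition positive_operator :: "('a::complex_inner \<Rightarrow> 'a) \<Rightarrow> bool" where
  "positive_operator T \<longleftrightarrow>
     T \<in> bounded_operators \<and> (\<forall>x. cinner (T x) x \<in> \<real>\<^sub>\<ge>\<^sub>0)"

definition closed_csubspace :: "'a::complex_inner set \<Rightarrow> bool" where
  "closed_csubspace M \<longleftrightarrow> module.subspace scaleC M \<and> closed M"

definition reduces :: "'a::chilbert_space set \<Rightarrow> ('a \<Rightarrow> 'a) \<Rightarrow> bool" where
  "reduces M T \<longleftrightarrow> closed_csubspace M \<and> T ` M \<subseteq> M \<and> cadjoint T ` M \<subseteq> M"

(* For an operator A on H that maps the subspace M into itself, the two notions below are those
   of the restriction of A to an operator on the Hilbert space M. *)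
definition min_modulus :: "'a::complex_inner set \<Rightarrow> ('a \<Rightarrow> 'a) \<Rightarrow> real" where
  "min_modulus M A = Inf {norm (A x) |x. x \<in> M \<and> norm x = 1}"

definition min_attaining :: "'a::complex_inner set \<Rightarrow> ('a \<Rightarrow> 'a) \<Rightarrow> bool" where
  "min_attaining M A \<longleftrightarrow> (\<exists>x\<^sub>0\<in>M. norm x\<^sub>0 = 1 \<and> norm (A x\<^sub>0) = min_modulus M A)"

definition reducing_min_attaining :: "('a::chilbert_space \<Rightarrow> 'a) set" where
  "reducing_min_attaining =
     {T \<in> bounded_operators. \<forall>M. reduces M T \<and> M \<noteq> {0} \<longrightarrow> min_attaining M T}"

definition spectrum :: "('a::complex_inner \<Rightarrow> 'a) \<Rightarrow> complex set" where
  "spectrum T =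
     {z. \<not> (\<exists>S \<in> bounded_operators. S \<circ> (\<lambda>x. T x - z *\<^sub>C x) = id \<and>
                                      (\<lambda>x. T x - z *\<^sub>C x) \<circ> S = id)}"

definition orthogonal_projection :: "('a::chilbert_space \<Rightarrow> 'a) \<Rightarrow> bool" where
  "orthogonal_projection P \<longleftrightarrow>
     P \<in> bounded_operators \<and> P \<circ> P = P \<and> cadjoint P = P"

(* Strong convergence of a series of operators is convergence at every vector. No enumeration of
   L is singled out, so sums over L are unordered sums. P is only relevant on L. *)
definition well_ordered_diagonalization ::
    "('a::chilbert_space \<Rightarrow> 'a) \<Rightarrow> real set \<Rightarrow> (real \<Rightarrow> 'a \<Rightarrow> 'a) \<Rightarrow> bool" where
  "well_ordered_diagonalization T L P \<longleftrightarrow>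
     countable L \<and> L \<subseteq> {0..onorm T} \<and>
     well_order_on L {(x, y). x \<in> L \<and> y \<in> L \<and> x \<le> y} \<and>
     (\<forall>l\<in>L. orthogonal_projection (P l) \<and> P l \<noteq> (\<lambda>x. 0)) \<and>
     (\<forall>k\<in>L. \<forall>l\<in>L. k \<noteq> l \<longrightarrow> P k \<circ> P l = (\<lambda>x. 0)) \<and>
     (\<forall>x. ((\<lambda>l. P l x) has_sum x) L) \<and>
     (\<forall>x. ((\<lambda>l. l *\<^sub>R P l x) has_sum T x) L)"

end

theory Submission
  imports Defs
begin

text \<open>If a positive operator attains its minimum modulus on a reducing subspace, it does so at an
  eigenvector there, and the minimum modulus is the eigenvalue. Hence, for \<open>T\<close> in
  \<open>\<M>\<^sub>r(H)\<close>, eigenvectors exist in every nonzero reducing subspace, which makes \<open>T\<close>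
  diagonal, and the eigenvalues belonging to a sum of eigenspaces have a least element, which makes
  them well-ordered. Conversely, for a diagonal operator the least eigenvalue whose projection is
  visible on a reducing subspace is attained there.\<close>

section \<open>Nearest points\<close>

text \<open>No spectral theorem enters: eigenvectors come from the first-order condition of a
  minimization. \<open>cadjoint\<close> is a definite description, so \<open>cadjoint P = P\<close>
  becomes a usable identity only once the Riesz representation has shown that adjoints exist; hence
  the start from nearest points. For a positive operator, reducing subspaces are exactly the closed
  invariant ones, and their orthogonal complements are again invariant, so eigenvectors can be
  sought in complements. The series over \<Lambda> come with no enumeration. What makes them
  converge is a bound on finite sums of mutually orthogonal projections that is uniform over the
  finite index sets. For a given diagonalization, one estimate obtained by comparing components
  serves twice: at \<open>z = 0\<close> it bounds the minimum modulus from below, and at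
  \<open>z\<close> outside the closure of \<Lambda> it bounds the inverse of
  \<open>T - z\<close>.\<close>

lemma quadratic_nonneg_linear_zero:
  fixes b c :: real
  assumes "\<And>t. 0 \<le> 2 * t * b + t\<^sup>2 * c"
  shows "b = 0"
proof (rule ccontr)
  assume b: "b \<noteq> 0"
  have c: "c \<ge> 0"
  proof (rule ccontr)
    assume "\<not> c \<ge> 0"
    moreover have "0 \<le> 2 * c" using assms[of 1] assms[of "-1"] by simp
    ultimately show False by simp
  qed
  \<comment> \<open>For \<open>c > 0\<close> the minimizer is \<open>- b / c\<close>; the
    denominator \<open>1 + c\<close> also covers \<open>c = 0\<close> and still makes the value
    negative.\<close>
  have "2 * (- b / (1 + c)) * b + (- b / (1 + c))\<^sup>2 * c = - (b\<^sup>2 * (2 + c)) / (1 + c)\<^sup>2"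
    using c by (simp add: divide_simps) (simp add: algebra_simps power2_eq_square)
  also have "\<dots> < 0"
    using b c by (simp add: divide_less_0_iff add_nonneg_pos)
  finally show False using assms[of "- b / (1 + c)"] by simp
qed

text \<open>A minimizing sequence is Cauchy by the parallelogram law: the midpoint of two of its
  terms stays in the convex set, so its distance to \<open>x\<close> is at least
  \<open>d\<close>.\<close>

theorem nearest_point_exists:
  fixes M :: "'a::{real_inner,complete_space} set"
  assumes "convex M" "closed M" "M \<noteq> {}"
  shows "\<exists>u\<in>M. \<forall>v\<in>M. norm (x - u) \<le> norm (x - v)"
proof -
  define d where "d = infdist x M"
  have d0: "d \<ge> 0" by (simp add: d_def infdist_nonneg)
  have dle: "d \<le> norm (x - v)" if "v \<in> M" for v
    using infdist_le[OF that, of x] by (simp add: d_def dist_norm)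
  have "\<exists>u\<in>M. norm (x - u) < d + inverse (real (Suc n))" for n
    using cInf_lessD[of "dist x ` M" "d + inverse (real (Suc n))"] assms(3)
    by (auto simp: d_def infdist_notempty dist_norm)
  then obtain u where uM: "\<And>n. u n \<in> M" and ud: "\<And>n. norm (x - u n) < d + inverse (real (Suc n))"
    by metis
  have lim: "(\<lambda>n. norm (x - u n)) \<longlonglongrightarrow> d"
  proof (rule real_tendsto_sandwich[where f = "\<lambda>_. d"])
    have "(\<lambda>n. d + inverse (real (Suc n))) \<longlonglongrightarrow> d + 0"
      by (intro tendsto_intros LIMSEQ_inverse_real_of_nat)
    then show "(\<lambda>n. d + inverse (real (Suc n))) \<longlonglongrightarrow> d" by simp
  qed (use dle uM less_imp_le[OF ud] in \<open>auto intro!: always_eventually\<close>)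
  have par: "(norm (u m - u n))\<^sup>2 \<le> 2 * (norm (x - u m))\<^sup>2 + 2 * (norm (x - u n))\<^sup>2 - 4 * d\<^sup>2" for m n
  proof -
    have "(1/2) *\<^sub>R u m + (1/2) *\<^sub>R u n \<in> M"
      using convexD[OF assms(1) uM[of m] uM[of n], of "1/2" "1/2"] by simp
    from dle[OF this] d0 have "d\<^sup>2 \<le> (norm (x - ((1/2) *\<^sub>R u m + (1/2) *\<^sub>R u n)))\<^sup>2"
      by (simp add: power_mono)
    then show ?thesis
      by (simp add: power2_norm_eq_inner inner_simps inner_commute algebra_simps)
  qed
  have "Cauchy u"
  proof (rule CauchyI)
    fix e :: real assume e: "e > 0"
    have "(\<lambda>n. (norm (x - u n))\<^sup>2) \<longlonglongrightarrow> d\<^sup>2"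
      by (intro tendsto_intros lim)
    \<comment> \<open>\<open>par\<close> doubles each excess over \<open>d\<^sup>2\<close>, so two
      excesses below \<open>e\<^sup>2 / 4\<close> together stay below
      \<open>e\<^sup>2\<close>.\<close>
    then have "\<forall>\<^sub>F n in sequentially. (norm (x - u n))\<^sup>2 < d\<^sup>2 + e\<^sup>2 / 4"
      using e by (intro order_tendstoD) auto
    then obtain N where N: "\<And>n. n \<ge> N \<Longrightarrow> (norm (x - u n))\<^sup>2 < d\<^sup>2 + e\<^sup>2 / 4"
      by (auto simp: eventually_sequentially)
    show "\<exists>N. \<forall>m\<ge>N. \<forall>n\<ge>N. norm (u m - u n) < e"
    proof (intro exI allI impI)
      fix m n assume "m \<ge> N" "n \<ge> N"
      then have "(norm (u m - u n))\<^sup>2 < e\<^sup>2"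
        using par[of m n] N[of m] N[of n] by simp
      then show "norm (u m - u n) < e" using e by (simp add: power2_less_imp_less)
    qed
  qed
  then obtain l where l: "u \<longlonglongrightarrow> l"
    using Cauchy_convergent_iff convergent_def by blast
  have "l \<in> M" using closed_sequentially[OF assms(2)] uM l by blast
  moreover have "norm (x - l) = d"
    by (rule LIMSEQ_unique[OF _ lim]) (intro tendsto_intros l)
  ultimately show ?thesis using dle by auto
qed

section \<open>Complex inner product spaces\<close>

lemma module_scaleC: "module (scaleC :: complex \<Rightarrow> 'a \<Rightarrow> 'a::complex_inner)"
  using vector_space_scaleC by (simp add: module_iff_vector_space)

lemma closed_csubspace_iff:
  fixes M :: "'a::complex_inner set"
  shows "closed_csubspace M \<longleftrightarrow>
    0 \<in> M \<and> (\<forall>x\<in>M. \<forall>y\<in>M. x + y \<in> M) \<and> (\<forall>c. \<forall>x\<in>M. c *\<^sub>C x \<in> M) \<and> closed M"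
  unfolding closed_csubspace_def module.subspace_def[OF module_scaleC] by auto

lemma closed_csubspace_zero: "closed_csubspace M \<Longrightarrow> 0 \<in> M"
  and closed_csubspace_add: "closed_csubspace M \<Longrightarrow> x \<in> M \<Longrightarrow> y \<in> M \<Longrightarrow> x + y \<in> M"
  and closed_csubspace_scaleC: "closed_csubspace M \<Longrightarrow> x \<in> M \<Longrightarrow> c *\<^sub>C x \<in> M"
  and closed_csubspace_closed: "closed_csubspace M \<Longrightarrow> closed M"
  by (simp_all add: closed_csubspace_iff)

lemma closed_csubspace_scaleR: "closed_csubspace M \<Longrightarrow> x \<in> M \<Longrightarrow> r *\<^sub>R x \<in> M"
  by (simp flip: scaleC_of_real add: closed_csubspace_scaleC)

lemma closed_csubspace_diff:
  assumes "closed_csubspace M" "x \<in> M" "y \<in> M" shows "x - y \<in> M"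
  using closed_csubspace_add[OF assms(1,2) closed_csubspace_scaleR[OF assms(1,3), of "-1"]] by simp

lemma subspace_of_closed_csubspace: "closed_csubspace M \<Longrightarrow> subspace M"
  by (simp add: real_vector.subspace_def closed_csubspace_zero closed_csubspace_add
      closed_csubspace_scaleR)

lemma scaleC_zero_right [simp]: "c *\<^sub>C (0::'a::complex_inner) = 0"
  using module.scale_zero_right[OF module_scaleC] .

lemma scaleC_zero_left [simp]: "0 *\<^sub>C (x::'a::complex_inner) = 0"
  using module.scale_zero_left[OF module_scaleC] .

lemma scaleC_one [simp]: "1 *\<^sub>C (x::'a::complex_inner) = x"
  using scaleC_of_real[of 1 x] by simp

lemma scaleC_diff_right: "c *\<^sub>C (x - y) = c *\<^sub>C x - c *\<^sub>C (y::'a::complex_inner)"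
  using module.scale_right_diff_distrib[OF module_scaleC] .

lemma scaleC_diff_left: "(a - b) *\<^sub>C x = a *\<^sub>C x - b *\<^sub>C (x::'a::complex_inner)"
  using module.scale_left_diff_distrib[OF module_scaleC] .

lemma cinner_add_right: "cinner x (y + z) = cinner x y + cinner x (z::'a::complex_inner)"
  by (metis cinner_add_left cinner_commute complex_cnj_add)

lemma cinner_scaleC_right: "cinner x (c *\<^sub>C y) = cnj c * cinner x (y::'a::complex_inner)"
  by (metis cinner_commute cinner_scaleC_left complex_cnj_mult)

lemma cinner_zero_left [simp]: "cinner 0 (x::'a::complex_inner) = 0"
  using cinner_scaleC_left[of 0 0 x] by simp

lemma cinner_zero_right [simp]: "cinner (x::'a::complex_inner) 0 = 0"
  using cinner_scaleC_right[of x 0 0] by simp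

lemma cinner_diff_left: "cinner (x - y) z = cinner x z - cinner y (z::'a::complex_inner)"
  using cinner_add_left[of "x - y" y z] by simp

lemma cinner_diff_right: "cinner z (x - y) = cinner z x - cinner z (y::'a::complex_inner)"
  using cinner_add_right[of z "x - y" y] by simp

lemma cinner_self_eq_0 [simp]: "cinner x x = 0 \<longleftrightarrow> x = (0::'a::complex_inner)"
  by (simp add: cinner_self)

lemma norm_scaleC [simp]: "norm (c *\<^sub>C (x::'a::complex_inner)) = cmod c * norm x"
proof -
  have "complex_of_real ((norm (c *\<^sub>C x))\<^sup>2) = c * cnj c * cinner x x"
    unfolding cinner_self[symmetric] by (simp add: cinner_scaleC_left cinner_scaleC_right)
  also have "\<dots> = complex_of_real ((cmod c * norm x)\<^sup>2)"
    by (simp only: complex_norm_square cinner_self power_mult_distrib of_real_mult)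
  finally have "(norm (c *\<^sub>C x))\<^sup>2 = (cmod c * norm x)\<^sup>2" 
    using of_real_eq_iff by blast
  then show ?thesis by (simp add: power2_eq_iff_nonneg)
qed

text \<open>Conjugate linearity in the second argument turns \<open>\<i>\<close> into a factor that
  moves the imaginary part into the real part. Complex statements thus reduce to real ones tested
  against \<open>y\<close> and \<open>\<i> *\<^sub>C y\<close>.\<close>

lemma Im_cinner: "Im (cinner x y) = x \<bullet> (\<i> *\<^sub>C (y::'a::complex_inner))"
  by (simp add: cinner_scaleC_right flip: cinner_Re)

lemma bounded_linear_scaleC: "bounded_linear (\<lambda>x. c *\<^sub>C (x::'a::complex_inner))"
proof (rule bounded_linear_intro[where K = "cmod c"])
  show "c *\<^sub>C r *\<^sub>R x = r *\<^sub>R c *\<^sub>C x" for r and x :: 'a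
    by (simp add: scaleC_scaleC mult.commute flip: scaleC_of_real)
qed (simp_all add: scaleC_add_right mult.commute)

lemma bounded_linear_cinner_left: "bounded_linear (\<lambda>x. cinner x (y::'a::complex_inner))"
\<comment> \<open>The factor 2 comes from applying the real Cauchy-Schwarz inequality to the real
  and imaginary parts separately; only boundedness matters.\<close>
proof (rule bounded_linear_intro[where K = "2 * norm y"])
  show "cinner (r *\<^sub>R x) y = r *\<^sub>R cinner x y" for r x
    by (simp add: cinner_scaleC_left scaleR_conv_of_real flip: scaleC_of_real)
  show "norm (cinner x y) \<le> norm x * (2 * norm y)" for x
  proof -
    have "norm (cinner x y) \<le> \<bar>x \<bullet> y\<bar> + \<bar>x \<bullet> (\<i> *\<^sub>C y)\<bar>"
      using cmod_le[of "cinner x y"] by (simp add: cinner_Re Im_cinner)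
    also have "\<dots> \<le> norm x * norm y + norm x * norm (\<i> *\<^sub>C y)"
      by (intro add_mono Cauchy_Schwarz_ineq2)
    finally show ?thesis by simp
  qed
qed (simp add: cinner_add_left)

section \<open>Orthogonal complements\<close>

definition cperp :: "'a::complex_inner set \<Rightarrow> 'a set" where
  "cperp M = {x. \<forall>y\<in>M. cinner x y = 0}"

lemma closed_csubspace_cperp: "closed_csubspace (cperp M)"
proof -
  have "cperp M = (\<Inter>y\<in>M. (\<lambda>x. cinner x y) -` {0})"
    by (auto simp: cperp_def)
  moreover have "closed ((\<lambda>x. cinner x y) -` {0})" for y :: 'a
    by (intro closed_vimage closed_singleton continuous_on_eq_continuous_within[THEN iffD2]
        linear_continuous_on bounded_linear_cinner_left)
  ultimately show ?thesis
    by (simp add: closed_csubspace_iff closed_INT)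
      (simp add: cperp_def cinner_add_left cinner_scaleC_left)
qed

lemma cperp_cinner: "x \<in> cperp M \<Longrightarrow> y \<in> M \<Longrightarrow> cinner x y = 0"
  by (simp add: cperp_def)

lemma cinner_cperp: "x \<in> M \<Longrightarrow> y \<in> cperp M \<Longrightarrow> cinner x y = 0"
  by (metis cperp_cinner cinner_commute complex_cnj_zero)

lemma subset_cperp_cperp: "M \<subseteq> cperp (cperp M)"
  by (auto simp: cinner_cperp cperp_def[of "cperp M"])

lemma cperp_disjoint: "x \<in> M \<Longrightarrow> x \<in> cperp M \<Longrightarrow> x = 0"
  using cperp_cinner by fastforce

text \<open>Moving the nearest point \<open>u\<close> along \<open>v\<close> gives a quadratic in
  \<open>t\<close> whose slope must vanish, which is real orthogonality. As the subspace is closed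
  under multiplication by \<open>\<i>\<close>, the imaginary part vanishes as well.\<close>

theorem orthogonal_decomposition:
  fixes M :: "'a::chilbert_space set"
  assumes M: "closed_csubspace M"
  obtains u v where "u \<in> M" "v \<in> cperp M" "x = u + v"
proof -
  obtain u where u: "u \<in> M" and near: "\<And>v. v \<in> M \<Longrightarrow> norm (x - u) \<le> norm (x - v)"
    using nearest_point_exists[of M x] subspace_imp_convex[OF subspace_of_closed_csubspace[OF M]]
      closed_csubspace_closed[OF M] closed_csubspace_zero[OF M] by blast
  have re: "(x - u) \<bullet> v = 0" if "v \<in> M" for v
  proof (rule quadratic_nonneg_linear_zero[where c = "(norm v)\<^sup>2"])
    fix t :: real
    have "u - t *\<^sub>R v \<in> M"
      using closed_csubspace_diff[OF M u closed_csubspace_scaleR[OF M that]] .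
    from power_mono[OF near[OF this], of 2]
    show "0 \<le> 2 * t * ((x - u) \<bullet> v) + t\<^sup>2 * (norm v)\<^sup>2"
      by (simp add: power2_norm_eq_inner inner_diff_left inner_diff_right inner_commute)
        (simp add: algebra_simps power2_eq_square)
  qed
  have "x - u \<in> cperp M"
    using re closed_csubspace_scaleC[OF M]
    by (auto simp: cperp_def complex_eq_iff cinner_Re Im_cinner)
  with u that[of u "x - u"] show ?thesis by simp
qed

section \<open>Adjoints and orthogonal projections\<close>

lemma bounded_operatorsD:
  assumes "T \<in> bounded_operators"
  shows bounded_operators_bounded_linear: "bounded_linear T"
    and bounded_operators_scaleC: "T (c *\<^sub>C x) = c *\<^sub>C T x"
  using assms by (simp_all add: bounded_operators_def)

lemma cinner_right_eqI:
  assumes "\<And>x. cinner x y = cinner x (z::'a::complex_inner)"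
  shows "y = z"
  using assms[of "y - z"] by (metis cinner_diff_right cinner_self_eq_0 right_minus_eq)

text \<open>Any \<open>x\<close> falls into the kernel after subtracting a multiple of a vector
  \<open>v\<close> orthogonal to the kernel, so \<open>f x\<close> can be read off from
  \<open>cinner x v\<close>.\<close>

theorem riesz_representation:
  fixes f :: "'a::chilbert_space \<Rightarrow> complex"
  assumes f: "bounded_linear f" and scale: "\<And>c x. f (c *\<^sub>C x) = c * f x"
  shows "\<exists>y. \<forall>x. f x = cinner x y"
proof (cases "\<forall>x. f x = 0")
  case True
  then show ?thesis by (intro exI[of _ 0]) simp
next
  case False
  then obtain x\<^sub>0 where x0: "f x\<^sub>0 \<noteq> 0" by blast
  interpret f: bounded_linear f by fact
  define K where "K = {x. f x = 0}"
  have "K = f -` {0}" by (auto simp: K_def)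
  then have "closed K"
    by (simp add: closed_vimage linear_continuous_on f)
  then have K: "closed_csubspace K"
    by (simp add: closed_csubspace_iff) (simp add: K_def f.zero f.add scale)
  obtain u v where uv: "u \<in> K" "v \<in> cperp K" "x\<^sub>0 = u + v"
    using orthogonal_decomposition[OF K] .
  have fv: "f v \<noteq> 0" using x0 uv by (auto simp: K_def f.add)
  then have v: "v \<noteq> 0" using f.zero by auto
  \<comment> \<open>The scalar is forced by \<open>cinner v y = f v\<close>; it is conjugated
    because the second argument is conjugate-linear.\<close>
  define y where "y = (cnj (f v) / cinner v v) *\<^sub>C v"
  have "f x = cinner x y" for x
  proof -
    have "x - (f x / f v) *\<^sub>C v \<in> K"
      using fv by (simp add: K_def f.diff scale)
    from cinner_cperp[OF this uv(2)] have "cinner x v = f x / f v * cinner v v"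
      by (simp add: cinner_diff_left cinner_scaleC_left)
    moreover have "cnj (cinner v v) = cinner v v" by (simp add: cinner_self)
    ultimately show ?thesis
      using fv v by (simp add: y_def cinner_scaleC_right)
  qed
  then show ?thesis by blast
qed

lemma cadjoint_eqI:
  assumes "\<And>x y. cinner (T x) y = cinner x (S y)"
  shows "cadjoint T = S"
  unfolding cadjoint_def
proof (rule the_equality)
  fix S' assume "\<forall>x y. cinner (T x) y = cinner x (S' y)"
  then have "cinner x (S' y) = cinner x (S y)" for x y using assms by metis
  then show "S' = S" by (intro ext cinner_right_eqI)
qed (use assms in blast)

lemma cinner_cadjoint:
  fixes T :: "'a::chilbert_space \<Rightarrow> 'a"
  assumes T: "T \<in> bounded_operators"
  shows "cinner (T x) y = cinner x (cadjoint T y)"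
proof -
  have "\<exists>z. \<forall>x. cinner (T x) y = cinner x z" for y
  proof (rule riesz_representation)
    show "bounded_linear (\<lambda>x. cinner (T x) y)"
      using bounded_linear_compose[OF bounded_linear_cinner_left
          bounded_operators_bounded_linear[OF T]] .
  qed (simp add: bounded_operators_scaleC[OF T] cinner_scaleC_left)
  then obtain S where S: "\<And>x y. cinner (T x) y = cinner x (S y)" by metis
  then have "cadjoint T = S" by (rule cadjoint_eqI)
  with S show ?thesis by simp
qed

lemma orthogonal_projectionD:
  assumes "orthogonal_projection P"
  shows orthogonal_projection_bounded: "P \<in> bounded_operators"
    and orthogonal_projection_idem: "P (P x) = P x"
    and cinner_orthogonal_projection: "cinner (P x) y = cinner x (P y)"
  using assms cinner_cadjoint[of P x y]
  by (auto simp: orthogonal_projection_def fun_eq_iff)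

lemma inner_orthogonal_projection:
  "orthogonal_projection P \<Longrightarrow> P x \<bullet> y = x \<bullet> P y"
  using cinner_orthogonal_projection[of P x y] by (metis cinner_Re)

lemma inner_orthogonal_projection_self:
  "orthogonal_projection P \<Longrightarrow> P x \<bullet> x = (norm (P x))\<^sup>2"
  using inner_orthogonal_projection[of P "P x" x]
  by (simp add: orthogonal_projection_idem power2_norm_eq_inner)

definition proj_onto :: "'a::chilbert_space set \<Rightarrow> 'a \<Rightarrow> 'a" where
  "proj_onto M x = (THE u. u \<in> M \<and> x - u \<in> cperp M)"

lemma proj_onto_eqI:
  assumes M: "closed_csubspace M" and u: "u \<in> M" "x - u \<in> cperp M"
  shows "proj_onto M x = u"
  unfolding proj_onto_def
proof (rule the_equality)
  fix w assume w: "w \<in> M \<and> x - w \<in> cperp M"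
  have "w - u \<in> M" using closed_csubspace_diff[OF M] w u by blast
  moreover have "(x - u) - (x - w) \<in> cperp M"
    using closed_csubspace_diff[OF closed_csubspace_cperp] w u by blast
  ultimately show "w = u" using cperp_disjoint[of "w - u" M] by simp
qed (use u in blast)

lemma
  assumes M: "closed_csubspace M"
  shows proj_onto_in: "proj_onto M x \<in> M"
    and proj_onto_perp: "x - proj_onto M x \<in> cperp M"
proof -
  obtain u v where uv: "u \<in> M" "v \<in> cperp M" "x = u + v"
    using orthogonal_decomposition[OF M] .
  then have "proj_onto M x = u" by (intro proj_onto_eqI[OF M]) auto
  with uv show "proj_onto M x \<in> M" "x - proj_onto M x \<in> cperp M" by auto
qed

lemma proj_onto_fixed: "closed_csubspace M \<Longrightarrow> x \<in> M \<Longrightarrow> proj_onto M x = x"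
  by (rule proj_onto_eqI) (simp_all add: cperp_def)

lemma proj_onto_eq_0_iff:
  assumes "closed_csubspace M"
  shows "proj_onto M x = 0 \<longleftrightarrow> x \<in> cperp M"
  using proj_onto_perp[OF assms, of x] proj_onto_eqI[OF assms closed_csubspace_zero[OF assms], of x]
  by auto

text \<open>Linearity follows from uniqueness, since the condition defining \<open>proj_onto\<close>
  is stable under sums and multiples. Symmetry holds because both sides equal the inner product of
  the two projected vectors.\<close>

lemma orthogonal_projection_proj_onto:
  assumes M: "closed_csubspace M"
  shows "orthogonal_projection (proj_onto M)"
proof -
  note in_M = proj_onto_in[OF M] and perp = proj_onto_perp[OF M]
  have sym: "cinner (proj_onto M x) y = cinner x (proj_onto M y)" for x y
    using cinner_cperp[OF in_M[of x] perp[of y]] cperp_cinner[OF perp[of x] in_M[of y]]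
    by (simp add: cinner_diff_left cinner_diff_right)
  have add: "proj_onto M (x + y) = proj_onto M x + proj_onto M y" for x y
    using closed_csubspace_add[OF closed_csubspace_cperp perp perp, of x y]
    by (intro proj_onto_eqI[OF M] closed_csubspace_add[OF M] in_M) (simp add: algebra_simps)
  have scale: "proj_onto M (c *\<^sub>C x) = c *\<^sub>C proj_onto M x" for c x
    using closed_csubspace_scaleC[OF closed_csubspace_cperp perp, of c x]
    by (intro proj_onto_eqI[OF M] closed_csubspace_scaleC[OF M] in_M) (simp add: scaleC_diff_right)
  have bound: "norm (proj_onto M x) \<le> norm x * 1" for x
  proof -
    have "(norm (proj_onto M x))\<^sup>2 = proj_onto M x \<bullet> x"
      using cinner_cperp[OF in_M[of x] perp[of x]]
      by (metis cinner_diff_right cinner_Re power2_norm_eq_inner right_minus_eq)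
    also have "\<dots> \<le> norm (proj_onto M x) * norm x" by (rule norm_cauchy_schwarz)
    finally show ?thesis
      by (cases "proj_onto M x = 0") (simp_all add: power2_eq_square)
  qed
  have "bounded_linear (proj_onto M)"
    by (rule bounded_linear_intro[OF add _ bound]) (metis scale scaleC_of_real)
  then have "proj_onto M \<in> bounded_operators"
    by (simp add: bounded_operators_def scale)
  then show ?thesis
    unfolding orthogonal_projection_def using cadjoint_eqI[OF sym] proj_onto_fixed[OF M in_M] by auto
qed

text \<open>The finite sum behaves like a single orthogonal projection \<open>Q\<close>:
  \<open>Q x \<bullet> Q x = Q x \<bullet> x\<close>, and Cauchy-Schwarz finishes.\<close>

lemma norm_sum_orthogonal_projections_le:
  fixes P :: "'i \<Rightarrow> 'a::chilbert_space \<Rightarrow> 'a"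
  assumes proj: "\<And>i. i \<in> F \<Longrightarrow> orthogonal_projection (P i)"
    and orth: "\<And>i j. i \<in> F \<Longrightarrow> j \<in> F \<Longrightarrow> i \<noteq> j \<Longrightarrow> P i (P j x) = 0"
    and "finite F"
  shows "norm (\<Sum>i\<in>F. P i x) \<le> norm x"
proof -
  have *: "P i x \<bullet> P j x = (if i = j then P i x \<bullet> x else 0)" if "i \<in> F" "j \<in> F" for i j
    using orth[OF that] inner_orthogonal_projection[OF proj[OF that(1)], of x "P j x"] 
      inner_orthogonal_projection_self[OF proj[OF that(1)], of x]
    by (auto simp: power2_norm_eq_inner)
  have "(norm (\<Sum>i\<in>F. P i x))\<^sup>2 = (\<Sum>i\<in>F. \<Sum>j\<in>F. P i x \<bullet> P j x)"
    by (simp add: power2_norm_eq_inner inner_sum_left inner_sum_right inner_commute)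
  also have "\<dots> = (\<Sum>i\<in>F. \<Sum>j\<in>F. if i = j then P i x \<bullet> x else 0)"
    by (intro sum.cong refl *)
  also have "\<dots> = (\<Sum>i\<in>F. P i x) \<bullet> x"
    using assms(3) by (simp add: inner_sum_left)
  also have "\<dots> \<le> norm (\<Sum>i\<in>F. P i x) * norm x" by (rule norm_cauchy_schwarz)
  finally show ?thesis
    by (cases "(\<Sum>i\<in>F. P i x) = 0") (simp_all add: power2_eq_square)
qed

text \<open>The vectors that equal the sum of their components form a closed subspace, closed
  because the partial sums are contractions uniformly in the finite set. It contains every
  \<open>P i y\<close>, so a vector \<open>v\<close> orthogonal to it satisfies
  \<open>P i v \<bullet> v = 0\<close>, hence \<open>P i v = 0\<close> for all \<open>i\<close>, and
  \<open>total\<close> makes it zero.\<close>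

theorem has_sum_orthogonal_projections:
  fixes P :: "'i \<Rightarrow> 'a::chilbert_space \<Rightarrow> 'a"
  assumes proj: "\<And>i. i \<in> I \<Longrightarrow> orthogonal_projection (P i)"
    and orth: "\<And>i j x. i \<in> I \<Longrightarrow> j \<in> I \<Longrightarrow> i \<noteq> j \<Longrightarrow> P i (P j x) = 0"
    and total: "\<And>x. (\<And>i. i \<in> I \<Longrightarrow> P i x = 0) \<Longrightarrow> x = 0"
  shows "((\<lambda>i. P i x) has_sum x) I"
proof -
  define M where "M = {x. ((\<lambda>i. P i x) has_sum x) I}"
  have bl: "bounded_linear (P i)" if "i \<in> I" for i
    using bounded_operators_bounded_linear orthogonal_projection_bounded proj[OF that] by blast
  have add: "x + y \<in> M" if "x \<in> M" "y \<in> M" for x y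
    using that has_sum_add[of "\<lambda>i. P i x" I x "\<lambda>i. P i y" y]
    by (simp add: M_def bl linear_simps(1) cong: has_sum_cong)
  have scale: "c *\<^sub>C x \<in> M" if "x \<in> M" for c x
    using that has_sum_bounded_linear[OF bounded_linear_scaleC, of "\<lambda>i. P i x" I x c]
    by (simp add: M_def o_def bounded_operators_scaleC[OF orthogonal_projection_bounded[OF proj]]
        cong: has_sum_cong)
  have PM: "P j y \<in> M" if "j \<in> I" for j y
    unfolding M_def mem_Collect_eq
  proof (rule has_sum_cong_neutral[THEN iffD1])
    show "((\<lambda>i. P i (P j y)) has_sum P j y) {j}"
      using has_sum_finite[of "{j}" "\<lambda>i. P i (P j y)"] that
      by (simp add: orthogonal_projection_idem proj)
  qed (use orth that in auto)
  have "closed M"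
  proof (rule closure_eq[THEN iffD1], rule equalityI[OF subsetI])
    fix x assume x: "x \<in> closure M"
    show "x \<in> M" unfolding M_def mem_Collect_eq has_sum_def
    proof (rule tendstoI)
      fix e :: real assume e: "e > 0"
      \<comment> \<open>One third each for passing from the partial sum at \<open>x\<close> to that
        at \<open>y\<close>, from there to \<open>y\<close>, and from \<open>y\<close> to
        \<open>x\<close>.\<close>
      obtain y where y: "y \<in> M" "dist y x < e / 3"
        using x e unfolding closure_approachable by (meson divide_pos_pos zero_less_numeral)
      have "\<forall>\<^sub>F F in finite_subsets_at_top I. dist (\<Sum>i\<in>F. P i y) y < e / 3"
        using y(1) e unfolding M_def mem_Collect_eq has_sum_def by (intro tendstoD) auto
      moreover have "\<forall>\<^sub>F F in finite_subsets_at_top I. finite F \<and> F \<subseteq> I"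
        by (rule eventually_finite_subsets_at_top_weakI) simp
      ultimately show "\<forall>\<^sub>F F in finite_subsets_at_top I. dist (\<Sum>i\<in>F. P i x) x < e"
      proof eventually_elim
        case (elim F)
        have "norm (\<Sum>i\<in>F. P i (x - y)) \<le> norm (x - y)"
          using elim proj orth by (intro norm_sum_orthogonal_projections_le) blast+
        also have "(\<Sum>i\<in>F. P i (x - y)) = (\<Sum>i\<in>F. P i x) - (\<Sum>i\<in>F. P i y)"
          using elim bl by (subst sum_subtractf[symmetric]) (auto intro!: sum.cong simp: linear_simps)
        finally have "dist (\<Sum>i\<in>F. P i x) (\<Sum>i\<in>F. P i y) \<le> dist y x"
          by (simp add: dist_norm norm_minus_commute)
        with elim y(2) show ?case
          using dist_triangle[of "\<Sum>i\<in>F. P i x" x "\<Sum>i\<in>F. P i y"] dist_triangle[of "\<Sum>i\<in>F. P i y" x y]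
          by linarith
      qed
    qed
  qed (rule closure_subset)
  moreover have "0 \<in> M"
    unfolding M_def mem_Collect_eq by (rule has_sum_0) (simp add: bl linear_simps)
  ultimately have M: "closed_csubspace M"
    by (simp add: closed_csubspace_iff add scale)
  obtain u v where uv: "u \<in> M" "v \<in> cperp M" "x = u + v"
    using orthogonal_decomposition[OF M] .
  have "P i v = 0" if "i \<in> I" for i
  proof -
    have "P i v \<bullet> v = 0"
      using cinner_cperp[OF PM[OF that, of v] uv(2)] cinner_Re[of "P i v" v] by simp
    then show ?thesis
      by (simp add: inner_orthogonal_projection_self proj that)
  qed
  then have "v = 0" by (rule total)
  with uv show ?thesis by (simp add: M_def)
qed

section \<open>Positive operators\<close>

text \<open>A positive operator is self-adjoint because \<open>\<langle>Tx, x\<rangle>\<close> is real; polarize with \<open>x + y\<close> and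
  \<open>x + \<i>y\<close>.\<close>

lemma positive_operatorD:
  fixes T :: "'a::complex_inner \<Rightarrow> 'a"
  assumes T: "positive_operator T"
  shows positive_operator_bounded: "T \<in> bounded_operators"
    and inner_positive_operator_nonneg: "T x \<bullet> x \<ge> 0"
    and cinner_positive_operator: "cinner (T x) y = cinner x (T y)"
proof -
  show bo: "T \<in> bounded_operators" using T by (simp add: positive_operator_def)
  interpret bounded_linear T by (rule bounded_operators_bounded_linear[OF bo])
  have real: "Im (cinner (T x) x) = 0" and nonneg: "Re (cinner (T x) x) \<ge> 0" for x
    using T by (auto simp: positive_operator_def complex_nonneg_Reals_iff)
  show "T x \<bullet> x \<ge> 0" using nonneg[of x] by (simp add: cinner_Re)
  have im: "Im (cinner (T x) y) = - Im (cinner (T y) x)" for x y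
    using real[of "x + y"] real[of x] real[of y]
    by (simp add: add cinner_add_left cinner_add_right)
  have "Re (cinner (T x) y) = Re (cinner (T y) x)" for x y
    using im[of x "\<i> *\<^sub>C y"]
    by (simp add: bounded_operators_scaleC[OF bo] cinner_scaleC_left cinner_scaleC_right)
  then have "cinner (T x) y = cnj (cinner (T y) x)"
    using im[of x y] by (intro complex_eqI) simp_all
  then show "cinner (T x) y = cinner x (T y)"
    using cinner_commute[of x "T y"] by simp
qed

lemma cadjoint_positive_operator: "positive_operator T \<Longrightarrow> cadjoint T = T"
  by (rule cadjoint_eqI) (rule cinner_positive_operator)

lemma reduces_positive_operator_iff:
  "positive_operator T \<Longrightarrow> reduces M T \<longleftrightarrow> closed_csubspace M \<and> (\<forall>x\<in>M. T x \<in> M)"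
  by (auto simp: reduces_def cadjoint_positive_operator)

lemma inner_positive_operator:
  "positive_operator T \<Longrightarrow> T x \<bullet> y = x \<bullet> T (y::'a::complex_inner)"
  by (metis cinner_positive_operator cinner_Re)

lemma cperp_invariant:
  assumes "positive_operator T" "\<And>x. x \<in> M \<Longrightarrow> T x \<in> M" "x \<in> cperp M"
  shows "T x \<in> cperp M"
  using assms by (simp add: cperp_def cinner_positive_operator)

definition eigenspace :: "('a::real_vector \<Rightarrow> 'a) \<Rightarrow> real \<Rightarrow> 'a set" where
  "eigenspace T l = {x. T x = l *\<^sub>R x}"

lemma closed_csubspace_eigenspace:
  assumes "T \<in> bounded_operators"
  shows "closed_csubspace (eigenspace T l)"
proof -
  interpret bounded_linear T by (rule bounded_operators_bounded_linear[OF assms])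
  have "closed (eigenspace T l)" unfolding eigenspace_def
    by (intro closed_Collect_eq continuous_intros linear_continuous_on bounded_linear_axioms)
  then show ?thesis
    by (simp add: closed_csubspace_iff)
      (simp add: eigenspace_def zero add scaleC_add_right bounded_operators_scaleC[OF assms]
        scaleC_scaleC mult.commute flip: scaleC_of_real)
qed

lemma eigenspaces_orthogonal:
  assumes T: "positive_operator T" and "k \<noteq> l" and x: "x \<in> eigenspace T k" and y: "y \<in> eigenspace T l"
  shows "cinner x y = 0"
proof -
  have "complex_of_real k * cinner x y = complex_of_real l * cinner x y"
    using cinner_positive_operator[OF T, of x y] x y
    by (simp add: eigenspace_def cinner_scaleC_left cinner_scaleC_right flip: scaleC_of_real)
  with \<open>k \<noteq> l\<close> show ?thesis by simp
qed

lemma min_modulus_le: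
  "x \<in> M \<Longrightarrow> norm x = 1 \<Longrightarrow> min_modulus M T \<le> norm (T x)"
  unfolding min_modulus_def by (intro cInf_lower bdd_belowI[of _ 0]) auto

text \<open>On an invariant subspace the form \<open>\<langle>Tx, Ty\<rangle> - m\<^sup>2\<langle>x, y\<rangle>\<close> is positive semidefinite, so a vector
  attaining the minimum modulus \<open>m\<close> is annihilated by \<open>T\<^sup>2 - m\<^sup>2\<close>. Positivity of \<open>T\<close> then rules
  out the eigenvalue \<open>-m\<close>.\<close>

lemma min_attaining_eigenvector:
  fixes T :: "'a::complex_inner \<Rightarrow> 'a"
  assumes T: "positive_operator T" and M: "closed_csubspace M" and inv: "\<And>x. x \<in> M \<Longrightarrow> T x \<in> M"
    and att: "min_attaining M T"
  obtains x where "x \<in> M" "norm x = 1" "T x = min_modulus M T *\<^sub>R x"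
proof -
  interpret bounded_linear T
    by (rule bounded_operators_bounded_linear[OF positive_operator_bounded[OF T]])
  define m where "m = min_modulus M T"
  obtain x where x: "x \<in> M" "norm x = 1" and Tx: "norm (T x) = m"
    using att by (auto simp: min_attaining_def m_def)
  have m0: "m \<ge> 0" using Tx norm_ge_zero by metis
  have bound: "m\<^sup>2 * (y \<bullet> y) \<le> T y \<bullet> T y" if "y \<in> M" for y
  proof (cases "y = 0")
    case False
    have "(1 / norm y) *\<^sub>R y \<in> M" by (rule closed_csubspace_scaleR[OF M that])
    from min_modulus_le[OF this, of T] False have "m \<le> norm (T y) / norm y"
      by (simp add: m_def scaleR divide_inverse mult.commute)
    then have "m * norm y \<le> norm (T y)" using False by (simp add: pos_le_divide_eq)
    then have "(m * norm y)\<^sup>2 \<le> (norm (T y))\<^sup>2" using m0 by (intro power_mono) auto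
    then show ?thesis by (simp add: power_mult_distrib power2_norm_eq_inner)
  qed (simp add: zero)
  \<comment> \<open>Equality holds in \<open>bound\<close> at \<open>x\<close>, so along
    \<open>x + t *\<^sub>R y\<close> the difference of its two sides is a nonnegative quadratic in
    \<open>t\<close> without constant term.\<close>
  have "T x \<bullet> T y - m\<^sup>2 * (x \<bullet> y) = 0" if y: "y \<in> M" for y
  proof (rule quadratic_nonneg_linear_zero)
    fix t :: real
    have "x + t *\<^sub>R y \<in> M"
      using closed_csubspace_add[OF M x(1) closed_csubspace_scaleR[OF M y]] .
    from bound[OF this]
    show "0 \<le> 2 * t * (T x \<bullet> T y - m\<^sup>2 * (x \<bullet> y)) + t\<^sup>2 * (T y \<bullet> T y - m\<^sup>2 * (y \<bullet> y))"
      unfolding add scaleR using dot_square_norm[of x] dot_square_norm[of "T x"] x(2) Tx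
      by (simp add: inner_add_left inner_add_right inner_commute)
        (simp add: algebra_simps power2_eq_square)
  qed
  then have "(T (T x) - m\<^sup>2 *\<^sub>R x) \<bullet> y = 0" if "y \<in> M" for y
    using that by (simp add: inner_diff_left inner_positive_operator[OF T, of "T x"])
  moreover have "T (T x) - m\<^sup>2 *\<^sub>R x \<in> M"
    by (intro closed_csubspace_diff[OF M] closed_csubspace_scaleR[OF M] inv x)
  ultimately have TTx: "T (T x) = m\<^sup>2 *\<^sub>R x" by (metis inner_eq_zero_iff right_minus_eq)
  \<comment> \<open>From the factorization \<open>(T + m) (T - m) x = 0\<close>, \<open>y\<close> is
    zero or an eigenvector for \<open>- m\<close>. Positivity excludes the latter if
    \<open>m > 0\<close>; if \<open>m = 0\<close>, then \<open>norm (T x) = m\<close> already gives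
    \<open>T x = 0\<close>.\<close>
  define y where "y = T x - m *\<^sub>R x"
  have "T y = - m *\<^sub>R y"
    by (simp add: y_def diff scaleR TTx power2_eq_square algebra_simps)
  then have "m * (y \<bullet> y) \<le> 0"
    using inner_positive_operator_nonneg[OF T, of y] by simp
  then have "T x = m *\<^sub>R x"
  proof (cases "m = 0")
    case True
    then show ?thesis using Tx by simp
  next
    case False
    with \<open>m * (y \<bullet> y) \<le> 0\<close> m0 have "y \<bullet> y \<le> 0" by (simp add: mult_le_0_iff)
    then have "y = 0" by (metis inner_gt_zero_iff linorder_not_less)
    then show ?thesis by (simp add: y_def)
  qed
  with x that show ?thesis by (simp add: m_def)
qed

section \<open>Countability and well-ordering of index sets\<close>

text \<open>Distinct orthonormal vectors are at distance \<open>sqrt 2\<close>, so a point of a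
  dense set within \<open>1 / 2\<close> of one of them determines its index.\<close>

lemma countable_orthonormal_family:
  fixes e :: "'i \<Rightarrow> 'a::real_inner"
  assumes sep: "separable_space (euclidean :: 'a topology)"
    and norm1: "\<And>i. i \<in> I \<Longrightarrow> norm (e i) = 1"
    and orth: "\<And>i j. i \<in> I \<Longrightarrow> j \<in> I \<Longrightarrow> i \<noteq> j \<Longrightarrow> e i \<bullet> e j = 0"
  shows "countable I"
proof -
  obtain C :: "'a set" where C: "countable C" "closure C = UNIV"
    using sep by (auto simp: separable_space_def)
  have "\<exists>c\<in>C. dist c (e i) < 1 / 2" for i
    using closure_approachable[THEN iffD1, rule_format, of "e i" C "1 / 2"] C(2) by simp
  then obtain c where c: "\<And>i. c i \<in> C" "\<And>i. dist (c i) (e i) < 1 / 2" by metis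
  have "inj_on c I"
  proof (rule inj_onI, rule ccontr)
    fix i j assume ij: "i \<in> I" "j \<in> I" "c i = c j" "i \<noteq> j"
    have "e i \<bullet> e i = 1" "e j \<bullet> e j = 1"
      using norm1 ij(1,2) by (simp_all add: dot_square_norm)
    then have "(norm (e i - e j))\<^sup>2 = 2"
      using orth[OF ij(1,2,4)]
      by (simp add: power2_norm_eq_inner inner_diff_left inner_diff_right inner_commute)
    moreover have "norm (e i - e j) < 1"
      using dist_triangle3[of "e i" "e j" "c i"] c(2)[of i] c(2)[of j] ij(3) by (simp add: dist_norm)
    then have "(norm (e i - e j))\<^sup>2 < 1" by (simp add: power_less_one_iff)
    ultimately show False by simp
  qed
  then show ?thesis
    using countable_subset[of "c ` I" C] c(1) C(1) by (auto intro: countable_image_inj_on)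
qed

text \<open>Both directions of the main equivalence handle well-ordering through least elements of
  nonempty subsets.\<close>

lemma well_order_on_le_iff:
  "well_order_on L {(x, y). x \<in> L \<and> y \<in> L \<and> x \<le> y} \<longleftrightarrow>
    (\<forall>S\<subseteq>L. S \<noteq> {} \<longrightarrow> (\<exists>m\<in>S. \<forall>y\<in>S. m \<le> (y::'b::linorder)))"
    (is "well_order_on L ?r \<longleftrightarrow> ?min")
proof
  assume "well_order_on L ?r"
  then have wf: "wf (?r - Id)" by (simp add: well_order_on_def)
  show ?min
  proof (intro allI impI)
    fix S assume S: "S \<subseteq> L" "S \<noteq> {}"
    then obtain x where "x \<in> S" by blast
    with wf obtain m where "m \<in> S" "\<And>y. (y, m) \<in> ?r - Id \<Longrightarrow> y \<notin> S"
      by (rule wfE_min) blast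
    with S(1) show "\<exists>m\<in>S. \<forall>y\<in>S. m \<le> y" by (intro bexI[of _ m]) force+
  qed
next
  assume min: ?min
  have "linear_order_on L ?r"
    by (auto simp: linear_order_on_def partial_order_on_def preorder_on_def refl_on_def trans_def
        antisym_def total_on_def)
  moreover have "wf (?r - Id)"
  proof (rule wfI_min)
    fix x Q assume "x \<in> (Q :: 'b set)"
    show "\<exists>z\<in>Q. \<forall>y. (y, z) \<in> ?r - Id \<longrightarrow> y \<notin> Q"
    \<comment> \<open>Well-foundedness quantifies over sets \<open>Q\<close> not confined to
      \<open>L\<close>; a point outside \<open>L\<close> has no predecessor in the relation.\<close>
    proof (cases "Q \<inter> L = {}")
      case True
      with \<open>x \<in> Q\<close> show ?thesis by auto
    next
      case False
      with min obtain m where "m \<in> Q \<inter> L" "\<forall>y\<in>Q \<inter> L. m \<le> y"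
        by (meson inf_le2)
      then show ?thesis by (intro bexI[of _ m]) force+
    qed
  qed
  ultimately show "well_order_on L ?r" by (simp add: well_order_on_def)
qed

section \<open>Diagonalizations\<close>

lemma has_sum_single:
  assumes "i \<in> I" "\<And>j. j \<in> I \<Longrightarrow> j \<noteq> i \<Longrightarrow> f j = 0"
  shows "(f has_sum f i) I"
proof (rule has_sum_cong_neutral[THEN iffD1])
  show "(f has_sum f i) {i}" using has_sum_finite[of "{i}" f] by simp
qed (use assms in auto)

context
  fixes T :: "'a::chilbert_space \<Rightarrow> 'a" and L P
  assumes diag: "well_ordered_diagonalization T L P"
begin

lemma diagonalization_projection: "l \<in> L \<Longrightarrow> orthogonal_projection (P l)"
  and diagonalization_has_sum: "((\<lambda>l. P l x) has_sum x) L"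
  and diagonalization_operator_has_sum: "((\<lambda>l. l *\<^sub>R P l x) has_sum T x) L"
  using diag by (simp_all add: well_ordered_diagonalization_def)

lemma diagonalization_orthogonal: "k \<in> L \<Longrightarrow> l \<in> L \<Longrightarrow> k \<noteq> l \<Longrightarrow> P k (P l x) = 0"
  using diag by (auto simp: well_ordered_diagonalization_def fun_eq_iff)

lemma diagonalization_bounded_linear: "l \<in> L \<Longrightarrow> bounded_linear (P l)"
  using diagonalization_projection orthogonal_projection_bounded bounded_operators_bounded_linear
  by blast

lemma diagonalization_eigenvector:
  assumes "l \<in> L"
  shows "T (P l x) = l *\<^sub>R P l x"
proof -
  have "((\<lambda>k. k *\<^sub>R P k (P l x)) has_sum l *\<^sub>R P l (P l x)) L"
    by (rule has_sum_single) (simp_all add: assms diagonalization_orthogonal)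
  from has_sum_unique[OF diagonalization_operator_has_sum this] show ?thesis
    by (simp add: orthogonal_projection_idem diagonalization_projection assms)
qed

text \<open>\<open>P l\<close> is continuous, so it may be applied to the series of
  \<open>T x\<close> term by term, where orthogonality leaves one term. Thus \<open>T\<close> acts
  on components as multiplication by \<open>l\<close>.\<close>

lemma diagonalization_component:
  assumes l: "l \<in> L"
  shows "P l (T x) = l *\<^sub>R P l x"
proof -
  interpret bounded_linear "P l" by (rule diagonalization_bounded_linear[OF l])
  have "((\<lambda>k. P l (k *\<^sub>R P k x)) has_sum P l (l *\<^sub>R P l x)) L"
    using l by (intro has_sum_single) (simp_all add: scaleR diagonalization_orthogonal)
  moreover have "((\<lambda>k. P l (k *\<^sub>R P k x)) has_sum P l (T x)) L"
    using has_sum_bounded_linear[OF bounded_linear_axioms diagonalization_operator_has_sum]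
    by (simp add: o_def)
  ultimately show ?thesis
    using has_sum_unique by (fastforce simp: scaleR orthogonal_projection_idem diagonalization_projection l)
qed

text \<open>Parseval's identity: pair the series for \<open>x\<close> with \<open>x\<close>, using
  \<open>P l x \<bullet> x = (norm (P l x))\<^sup>2\<close>.\<close>

lemma diagonalization_norm_has_sum: "((\<lambda>l. (norm (P l x))\<^sup>2) has_sum (norm x)\<^sup>2) L"
proof -
  have "((\<lambda>l. P l x \<bullet> x) has_sum (x \<bullet> x)) L"
    using has_sum_bounded_linear[OF bounded_linear_inner_left diagonalization_has_sum]
    by (simp add: o_def)
  then show ?thesis unfolding dot_square_norm
    by (simp add: inner_orthogonal_projection_self diagonalization_projection cong: has_sum_cong)
qed

text \<open>Parseval on both sides, since the components of \<open>T x - z *\<^sub>C x\<close> are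
  those of \<open>x\<close> times \<open>l - z\<close>. Restricting \<open>d\<close> to indices with
  \<open>P l x \<noteq> 0\<close> lets the bound see only the eigenvalues visible on a given
  subspace.\<close>

lemma diagonalization_lower_bound:
  assumes "d \<ge> 0" and d: "\<And>l. l \<in> L \<Longrightarrow> P l x \<noteq> 0 \<Longrightarrow> d \<le> cmod (complex_of_real l - z)"
  shows "d * norm x \<le> norm (T x - z *\<^sub>C x)"
proof -
  have "d\<^sup>2 * (norm x)\<^sup>2 \<le> (norm (T x - z *\<^sub>C x))\<^sup>2"
  proof (rule has_sum_mono[OF has_sum_cmult_right[OF diagonalization_norm_has_sum]
        diagonalization_norm_has_sum])
    fix l assume l: "l \<in> L"
    have "P l (T x - z *\<^sub>C x) = (complex_of_real l - z) *\<^sub>C P l x"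
      using bounded_operators_scaleC[OF orthogonal_projection_bounded[OF diagonalization_projection[OF l]]]
      by (simp add: linear_simps(2)[OF diagonalization_bounded_linear[OF l]]
          diagonalization_component[OF l] scaleC_diff_left scaleC_of_real)
    moreover have "d * norm (P l x) \<le> cmod (complex_of_real l - z) * norm (P l x)"
      using d[OF l] by (cases "P l x = 0") (auto intro: mult_right_mono)
    ultimately show "d\<^sup>2 * (norm (P l x))\<^sup>2 \<le> (norm (P l (T x - z *\<^sub>C x)))\<^sup>2"
      using \<open>d \<ge> 0\<close> unfolding power_mult_distrib[symmetric] by (intro power_mono) simp_all
  qed
  then show ?thesis
    unfolding power_mult_distrib[symmetric] by (rule power2_le_imp_le) simp
qed

text \<open>On the range of \<open>P l\<close> the operator \<open>T - r\<close> is multiplication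
  by \<open>l - r\<close>. An inverse with bound \<open>K\<close> would force
  \<open>\<bar>l - r\<bar> \<ge> 1 / K\<close> for every \<open>l\<close> in \<open>L\<close>,
  although \<open>L\<close> comes arbitrarily close to \<open>r\<close>.\<close>

lemma closure_subset_spectrum: "complex_of_real ` closure L \<subseteq> spectrum T"
proof clarify
  fix r assume r: "r \<in> closure L"
  show "complex_of_real r \<in> spectrum T"
  proof (rule ccontr)
    assume "complex_of_real r \<notin> spectrum T"
    then obtain S where S: "S \<in> bounded_operators"
      and inv: "S \<circ> (\<lambda>x. T x - complex_of_real r *\<^sub>C x) = id"
      by (auto simp: spectrum_def)
    obtain K where K: "K > 0" "\<And>x. norm (S x) \<le> norm x * K"
      using bounded_linear.pos_bounded[OF bounded_operators_bounded_linear[OF S]] by blast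
    obtain l where l: "l \<in> L" "dist l r < 1 / K"
      using r K(1) by (meson closure_approachable zero_less_divide_1_iff)
    obtain x where "P l x \<noteq> 0"
      using diag l(1) unfolding well_ordered_diagonalization_def by (metis ext)
    moreover have "S ((l - r) *\<^sub>R P l x) = P l x"
      using fun_cong[OF inv, of "P l x"]
      by (simp add: diagonalization_eigenvector[OF l(1)] scaleC_of_real scaleR_diff_left)
    with K(2)[of "(l - r) *\<^sub>R P l x"] have "norm (P l x) \<le> \<bar>l - r\<bar> * norm (P l x) * K"
      by simp
    ultimately have "1 \<le> \<bar>l - r\<bar> * K" by (simp add: mult.assoc mult.left_commute)
    with l(2) K(1) show False by (simp add: dist_real_def pos_less_divide_eq)
  qed
qed

text \<open>Away from \<open>closure L\<close> the operator \<open>T - z\<close> is bounded below, so its range is closed; the range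
  contains every \<open>P l x\<close> and hence is everything.\<close>

lemma spectrum_subset_closure:
  assumes T: "T \<in> bounded_operators"
  shows "spectrum T \<subseteq> complex_of_real ` closure L"
proof (rule subsetI, rule ccontr)
  fix z assume z: "z \<in> spectrum T" "z \<notin> complex_of_real ` closure L"
  \<comment> \<open>For real \<open>z\<close> the gap comes from the closure taken in the reals; for
    other \<open>z\<close> the imaginary part is itself a gap.\<close>
  obtain d where d: "d > 0" "\<And>l. l \<in> L \<Longrightarrow> d \<le> cmod (complex_of_real l - z)"
  proof (cases "Im z = 0")
    case True
    then have z_eq: "z = complex_of_real (Re z)" by (simp add: complex_eq_iff)
    with z(2) have "Re z \<notin> closure L" by blast
    then obtain d where d: "d > 0" "\<And>l. l \<in> L \<Longrightarrow> d \<le> dist l (Re z)"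
      by (meson closure_approachable linorder_not_less)
    have "d \<le> cmod (complex_of_real l - z)" if "l \<in> L" for l
      using d(2)[OF that] abs_Re_le_cmod[of "complex_of_real l - z"] by (simp add: dist_real_def)
    with d(1) that show ?thesis by blast
  next
    case False
    have "\<bar>Im z\<bar> \<le> cmod (complex_of_real l - z)" for l
      using abs_Im_le_cmod[of "complex_of_real l - z"] by simp
    with False that[of "\<bar>Im z\<bar>"] show ?thesis by simp
  qed
  define A where "A = (\<lambda>x. T x - z *\<^sub>C x)"
  have A: "bounded_linear A"
    unfolding A_def
    by (intro bounded_linear_sub bounded_linear_scaleC bounded_operators_bounded_linear[OF T])
  interpret A: bounded_linear A by (rule A)
  have A_scaleC: "A (c *\<^sub>C x) = c *\<^sub>C A x" for c x
    by (simp add: A_def bounded_operators_scaleC[OF T] scaleC_diff_right scaleC_scaleC mult.commute)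
  have below: "d * norm x \<le> norm (A x)" for x
    unfolding A_def using d by (intro diagonalization_lower_bound) auto
  have inj: "inj A"
  proof (rule injI)
    fix x y assume "A x = A y"
    then show "x = y" using below[of "x - y"] d(1) by (simp add: A.diff mult_le_0_iff)
  qed
  have "complete (range A)"
    by (rule complete_isometric_image[OF d(1) subspace_UNIV A]) (use below complete_UNIV in auto)
  then have closed: "closed (range A)" by (rule complete_imp_closed)
  have sub: "subspace (range A)"
    using real_vector.linear_subspace_image[OF A.linear subspace_UNIV] .
  have P_range: "P l x \<in> range A" if l: "l \<in> L" for l x
  proof
    have "complex_of_real l - z \<noteq> 0" using d(2)[OF l] d(1) by auto
    then show "P l x = A ((1 / (complex_of_real l - z)) *\<^sub>C P l x)"
      by (simp add: A_scaleC)
        (simp add: A_def diagonalization_eigenvector[OF l] scaleC_scaleC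
          flip: scaleC_of_real scaleC_diff_left)
  qed simp
  have surj: "surj A"
  proof (unfold surj_def, rule allI)
    fix x
    have "x \<in> range A"
    proof (rule Lim_in_closed_set[OF closed])
      show "((\<lambda>F. \<Sum>l\<in>F. P l x) \<longlongrightarrow> x) (finite_subsets_at_top L)"
        using diagonalization_has_sum[of x] by (simp add: has_sum_def)
      show "\<forall>\<^sub>F F in finite_subsets_at_top L. (\<Sum>l\<in>F. P l x) \<in> range A"
        by (rule eventually_finite_subsets_at_top_weakI)
          (use P_range in \<open>auto intro!: real_vector.subspace_sum[OF sub]\<close>)
    qed simp
    then show "\<exists>y. x = A y" by blast
  qed
  have A_inv: "A (inv A x) = x" for x by (rule surj_f_inv_f[OF surj])
  have inv_eqI: "inv A y = x" if "A x = y" for x y using inv_f_f[OF inj] that by blast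
  have "bounded_linear (inv A)"
  proof (rule bounded_linear_intro)
    show "inv A (x + y) = inv A x + inv A y" for x y
      by (rule inv_eqI) (simp add: A.add A_inv)
    show "inv A (r *\<^sub>R x) = r *\<^sub>R inv A x" for r x
      by (rule inv_eqI) (simp add: A.scaleR A_inv)
    show "norm (inv A x) \<le> norm x * (1 / d)" for x
      using below[of "inv A x"] d(1) by (simp add: A_inv pos_le_divide_eq mult.commute)
  qed
  moreover have "inv A (c *\<^sub>C x) = c *\<^sub>C inv A x" for c x
    by (rule inv_eqI) (simp add: A_scaleC A_inv)
  ultimately have "inv A \<in> bounded_operators"
    by (simp add: bounded_operators_def)
  moreover have "inv A \<circ> A = id" "A \<circ> inv A = id"
    using inj A_inv by (auto simp: fun_eq_iff)
  ultimately show False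
    using z(1) unfolding spectrum_def A_def by blast
qed

text \<open>In an invariant subspace \<open>M\<close>, let \<open>m\<close> be the least \<open>l\<close> such that \<open>P l\<close> does not vanish on \<open>M\<close>.
  Then \<open>m\<close> bounds \<open>T\<close> below on \<open>M\<close>, and the component in \<open>M\<close> of a nonzero \<open>P m x\<close> with \<open>x \<in> M\<close>
  is an eigenvector for \<open>m\<close>.\<close>

lemma reducing_min_attaining_of_diagonalization:
  assumes T: "positive_operator T"
  shows "T \<in> reducing_min_attaining"
  unfolding reducing_min_attaining_def
proof (intro CollectI conjI allI impI)
  show bo: "T \<in> bounded_operators" by (rule positive_operator_bounded[OF T])
  interpret bounded_linear T by (rule bounded_operators_bounded_linear[OF bo])
  fix M assume "reduces M T \<and> M \<noteq> {0}"
  then have "M \<noteq> {0}" and M: "closed_csubspace M" and inv: "\<And>x. x \<in> M \<Longrightarrow> T x \<in> M"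
    by (simp_all add: reduces_positive_operator_iff[OF T])
  then obtain w where w: "w \<in> M" "w \<noteq> 0"
    using closed_csubspace_zero by blast
  define S where "S = {l \<in> L. \<exists>x\<in>M. P l x \<noteq> 0}"
  have "S \<noteq> {}"
  proof
    assume "S = {}"
    then have "((\<lambda>l. P l w) has_sum 0) L"
      using w by (intro has_sum_0) (auto simp: S_def)
    then show False using has_sum_unique diagonalization_has_sum w(2) by blast
  qed
  then obtain m where m: "m \<in> S" and least: "\<And>l. l \<in> S \<Longrightarrow> m \<le> l"
    using diag unfolding well_ordered_diagonalization_def well_order_on_le_iff
    by (metis (no_types, lifting) S_def mem_Collect_eq subsetI)
  then have mL: "m \<in> L" by (simp add: S_def)
  have L0: "l \<ge> 0" if "l \<in> L" for l
    using that diag by (auto simp: well_ordered_diagonalization_def)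
  obtain x where x: "x \<in> M" "P m x \<noteq> 0" using m by (auto simp: S_def)
  obtain u v where uv: "u \<in> M" "v \<in> cperp M" "P m x = u + v"
    using orthogonal_decomposition[OF M] .
  \<comment> \<open>Split the eigenvalue equation of \<open>P m x\<close> along \<open>M\<close> and
    its complement, both invariant: the two sides lie in orthogonal subspaces, so both
    vanish.\<close>
  have "T u - m *\<^sub>R u = m *\<^sub>R v - T v"
    using diagonalization_eigenvector[OF mL, of x] by (simp add: uv(3) add algebra_simps)
  moreover have "T u - m *\<^sub>R u \<in> M"
    by (intro closed_csubspace_diff[OF M] closed_csubspace_scaleR[OF M] inv uv(1))
  moreover have "m *\<^sub>R v - T v \<in> cperp M"
    by (intro closed_csubspace_diff closed_csubspace_scaleR closed_csubspace_cperp
        cperp_invariant[OF T inv] uv(2))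
  ultimately have Tu: "T u = m *\<^sub>R u"
    using cperp_disjoint by (metis right_minus_eq)
  \<comment> \<open>Otherwise \<open>P m x\<close> would be orthogonal to \<open>x\<close>, which
    lies in \<open>M\<close>, although \<open>P m x \<bullet> x\<close> is the squared norm of
    \<open>P m x\<close>.\<close>
  have "u \<noteq> 0"
  proof
    assume "u = 0"
    then have "P m x \<bullet> x = 0"
      using cperp_cinner[OF uv(2) x(1)] uv(3) cinner_Re[of v x] by simp
    then show False
      using x(2) by (simp add: inner_orthogonal_projection_self diagonalization_projection mL)
  qed
  define y where "y = (1 / norm u) *\<^sub>R u"
  have y: "y \<in> M" "norm y = 1" "norm (T y) = m"
    using \<open>u \<noteq> 0\<close> closed_csubspace_scaleR[OF M uv(1)] L0[OF mL] by (simp_all add: y_def scaleR Tu)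
  have "m * norm x' \<le> norm (T x')" if "x' \<in> M" for x'
    using diagonalization_lower_bound[of m x' 0] L0 mL least that by (auto simp: S_def)
  then have "m \<le> min_modulus M T"
    unfolding min_modulus_def using y(1,2) by (intro cInf_greatest) fastforce+
  with min_modulus_le[OF y(1,2), of T] y show "min_attaining M T"
    unfolding min_attaining_def by (intro bexI[of _ y]) auto
qed

end

text \<open>The projections are those onto the eigenspaces of \<open>T\<close>. The orthogonal complement of all
  eigenspaces contains no eigenvector, so it is trivial; for a set \<open>S\<close> of eigenvalues, the minimum
  modulus of \<open>T\<close> on the closed span of the eigenspaces of \<open>S\<close> is the least element of \<open>S\<close>.\<close>

theorem diagonalization_of_reducing_min_attaining:
  fixes T :: "'a::chilbert_space \<Rightarrow> 'a"
  assumes sep: "separable_space (euclidean :: 'a topology)"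
    and T: "positive_operator T" and att: "T \<in> reducing_min_attaining"
  shows "\<exists>L P. well_ordered_diagonalization T L P"
proof -
  have bo: "T \<in> bounded_operators" by (rule positive_operator_bounded[OF T])
  have bl: "bounded_linear T" by (rule bounded_operators_bounded_linear[OF bo])
  interpret bounded_linear T by (rule bl)
  define E where "E = eigenspace T"
  define L where "L = {l. E l \<noteq> {0}}"
  define P where "P l = proj_onto (E l)" for l
  have E: "closed_csubspace (E l)" for l
    unfolding E_def by (rule closed_csubspace_eigenspace[OF bo])
  have E_iff: "x \<in> E l \<longleftrightarrow> T x = l *\<^sub>R x" for x l by (simp add: E_def eigenspace_def)
  have perp: "x \<in> cperp (E k)" if "k \<noteq> l" "x \<in> E l" for k l x
    using that eigenspaces_orthogonal[OF T, of l k x] by (auto simp: cperp_def E_def)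
  have "\<exists>x. x \<in> E l \<and> norm x = 1" if "l \<in> L" for l
  proof -
    obtain x where "x \<in> E l" "x \<noteq> 0" using \<open>l \<in> L\<close> closed_csubspace_zero[OF E] by (auto simp: L_def)
    then show ?thesis
      by (intro exI[of _ "(1 / norm x) *\<^sub>R x"]) (simp add: closed_csubspace_scaleR[OF E])
  qed
  then obtain e where e: "\<And>l. l \<in> L \<Longrightarrow> e l \<in> E l" "\<And>l. l \<in> L \<Longrightarrow> norm (e l) = 1" by metis
  have e_nz: "e l \<noteq> 0" if "l \<in> L" for l using e(2)[OF that] by auto
  have nonneg: "l \<ge> 0" if "l \<in> L" for l
    using inner_positive_operator_nonneg[OF T, of "e l"] e[OF that]
    by (simp add: E_iff dot_square_norm)
  have norm_Te: "norm (T (e l)) = l" if "l \<in> L" for l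
    using e[OF that] nonneg[OF that] by (simp add: E_iff)
  have eigenvector: "\<exists>x\<in>M. norm x = 1 \<and> T x = min_modulus M T *\<^sub>R x"
    if "closed_csubspace M" "\<And>x. x \<in> M \<Longrightarrow> T x \<in> M" "M \<noteq> {0}" for M
  proof -
    have "min_attaining M T"
      using that att by (simp add: reducing_min_attaining_def reduces_positive_operator_iff[OF T])
    from min_attaining_eigenvector[OF T that(1,2) this] show ?thesis by blast
  qed
  \<comment> \<open>\<open>N L\<close> is where an eigenvector missed by \<open>L\<close> would
    live; \<open>cperp (N S)\<close> is the closed span of the eigenspaces of \<open>S\<close>,
    obtained as a double complement.\<close>
  define N where "N S = cperp (\<Union>l\<in>S. E l)" for S
  have N: "closed_csubspace (N S)" for S
    by (simp add: N_def closed_csubspace_cperp)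
  have N_inv: "T x \<in> N S" if "x \<in> N S" for x S
    using that unfolding N_def
    by (rule cperp_invariant[OF T, rotated]) (auto simp: E_iff scaleR)
  have N_iff: "x \<in> N S \<longleftrightarrow> (\<forall>l\<in>S. x \<in> cperp (E l))" for x S
    by (auto simp: N_def cperp_def)

  have total: "x = 0" if x: "\<And>l. l \<in> L \<Longrightarrow> P l x = 0" for x
  proof (rule ccontr)
    assume "x \<noteq> 0"
    have "x \<in> N L" using x by (simp add: N_iff P_def proj_onto_eq_0_iff[OF E])
    with \<open>x \<noteq> 0\<close> have "N L \<noteq> {0}" by blast
    from eigenvector[OF N N_inv this] obtain y m
      where y: "y \<in> N L" "norm y = 1" "y \<in> E m" unfolding E_iff by blast
    then have "y \<noteq> 0" by auto
    with y(3) have "m \<in> L" by (auto simp: L_def)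
    with y(1) have "y \<in> cperp (E m)" by (simp add: N_iff)
    with y(3) have "y = 0" by (rule cperp_disjoint)
    with \<open>y \<noteq> 0\<close> show False by simp
  qed

  have least: "\<exists>m\<in>S. \<forall>l\<in>S. m \<le> l" if S: "S \<subseteq> L" "S \<noteq> {}" for S
  proof -
    define M where "M = cperp (N S)"
    have M: "closed_csubspace M" by (simp add: M_def closed_csubspace_cperp)
    have M_inv: "T x \<in> M" if "x \<in> M" for x
      using cperp_invariant[OF T N_inv] that unfolding M_def by blast
    have eM: "e l \<in> M" if "l \<in> S" for l
      unfolding M_def N_def using e(1) S(1) that
      by (intro subset_cperp_cperp[THEN subsetD]) blast
    with S e_nz have "M \<noteq> {0}" by blast
    from eigenvector[OF M M_inv this] obtain y
      where y: "y \<in> M" "norm y = 1" "y \<in> E (min_modulus M T)" unfolding E_iff by blast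
    \<comment> \<open>With an eigenvalue outside \<open>S\<close>, \<open>y\<close> would be
      orthogonal to all eigenspaces of \<open>S\<close>, hence lie both in \<open>N S\<close> and in
      its complement.\<close>
    have "min_modulus M T \<in> S"
    proof (rule ccontr)
      assume "min_modulus M T \<notin> S"
      with y(3) perp have "y \<in> N S" unfolding N_iff by metis
      with y cperp_disjoint[of y "N S"] show False by (auto simp: M_def)
    qed
    moreover have "min_modulus M T \<le> l" if "l \<in> S" for l
      using min_modulus_le[OF eM e(2), of l T] norm_Te S(1) that by auto
    ultimately show ?thesis by blast
  qed

  have proj: "orthogonal_projection (P l)" for l
    unfolding P_def by (rule orthogonal_projection_proj_onto[OF E])
  have orth: "P k (P l x) = 0" if "k \<noteq> l" for k l x
    using perp[OF that proj_onto_in[OF E]] by (simp add: P_def proj_onto_eq_0_iff[OF E])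
  have sum: "((\<lambda>l. P l x) has_sum x) L" for x
    using proj orth total by (intro has_sum_orthogonal_projections) auto
  have "((\<lambda>l. l *\<^sub>R P l x) has_sum T x) L" for x
    using has_sum_bounded_linear[OF bl sum] proj_onto_in[OF E] by (simp add: o_def P_def E_iff)
  moreover have "countable L"
  proof (rule countable_orthonormal_family[OF sep e(2)])
    fix k l assume "k \<in> L" "l \<in> L" "k \<noteq> l"
    then have "cinner (e k) (e l) = 0"
      using eigenspaces_orthogonal[OF T] e(1) unfolding E_def by blast
    then show "e k \<bullet> e l = 0" using cinner_Re[of "e k" "e l"] by simp
  qed
  moreover have "L \<subseteq> {0..onorm T}"
  proof
    fix l assume l: "l \<in> L"
    show "l \<in> {0..onorm T}"
      using onorm[OF bl, of "e l"] norm_Te[OF l] e(2)[OF l] nonneg[OF l] by simp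
  qed
  moreover have "P l \<noteq> (\<lambda>x. 0)" if "l \<in> L" for l
    using proj_onto_fixed[OF E e(1)[OF that]] e_nz[OF that] by (metis P_def)
  ultimately have "well_ordered_diagonalization T L P"
    using least proj orth sum
    by (simp add: well_ordered_diagonalization_def well_order_on_le_iff fun_eq_iff)
  then show ?thesis by blast
qed

theorem theorem4p7:
  fixes T :: "'a::chilbert_space \<Rightarrow> 'a"
  assumes "infinite_dimensional TYPE('a)"
    and "separable_space (euclidean :: 'a topology)"
    and "positive_operator T"
  shows "(T \<in> reducing_min_attaining \<longleftrightarrow> (\<exists>\<Lambda> P. well_ordered_diagonalization T \<Lambda> P)) \<and>
         (\<forall>\<Lambda> P. well_ordered_diagonalization T \<Lambda> P \<longrightarrow>
            spectrum T = complex_of_real ` closure \<Lambda>)"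
  using diagonalization_of_reducing_min_attaining[OF assms(2,3)]
    reducing_min_attaining_of_diagonalization[OF _ assms(3)]
    spectrum_subset_closure[OF _ positive_operator_bounded[OF assms(3)]]
    closure_subset_spectrum
  by blast

end
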